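(* (Cover) For every name $P$: if $\eta\,P\,\mathrm{balls}$, then $\eta\,P\,\mathcal{G}(P)$. (Intersection) For all names $P,B,Q$: if $\eta\,P\,\mathcal{G}(B)$ and $\eta\,P\,\mathcal{G}(Q)$, then there exists $D$ such that $\eta\,D\,\mathrm{balls}$, $\eta\,P\,\mathcal{G}(D)$, $\mathrm{PointSet\_incl}(\mathcal{G}(D),\mathcal{G}(B))$ and $\mathrm{PointSet\_incl}(\mathcal{G}(D),\mathcal{G}(Q))$.
   Context: Logic is classical. Names form a type $N$; a name may designate zero, one or several objects. The relation $\eta : N\to N\to \mathrm{Prop}$ (singular inclusion) is governed by Leśniewski's Ontology: $\eta\,A\,b$ holds iff [there is $C$ with $\eta\,C\,A$] and [for all $C,D$, $\eta\,C\,A$ and $\eta\,D\,A$ imply $\eta\,C\,D$] and [for all $C$, $\eta\,C\,A$ implies $\eta\,C\,b$]; i.e. $A$ designates exactly one object, which is among those designated by $b$. $A$ is an Individual iff $\eta\,A\,A$. Notation: $P\equiv Q$ iff $\eta\,P\,Q$ and $\eta\,Q\,P$; $a\approx b$ iff $\forall P,\ \eta\,P\,a\leftrightarrow\eta\,P\,b$. Names with the same extension are interchangeable. Name-forming operators are introduced by stating when $\eta\,P\,(\cdot)$ holds. Mereology: $\eta\,P\,(\mathrm{pt}(Q))$ ("$P$ is a part of $Q$") relates individuals and is reflexive on individuals, transitive, and antisymmetric up to $\equiv$; a proper part of $Q$ is a part $P$ with not $P\equiv Q$; $\eta\,P\,(\mathrm{ext}(Q))$ ("$P$ is external to $Q$")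 means $P,Q$ are individuals with no common part. Geometry: $\mathrm{balls}$ is a primitive name whose members are individuals (balls); at least one ball exists. $\eta\,P\,(\mathrm{Concent}(Q))$ means that the balls $P,Q$ are concentric in Tarski's sense: $P\equiv Q$; or $P$ is a proper part of $Q$ and any two balls $X,Y$ externally diametrical to $P$ and internally tangent to $Q$ are internally diametrical to $Q$; or the same with $P,Q$ exchanged. Here (all variables balls): $A$ is externally tangent to $B$ if $A$ is external to $B$ and of any two balls $X,Y$ having $A$ as part and external to $B$ one is part of the other; $A$ is internally tangent to $B$ if $A$ is a proper part of $B$ and of any two balls $X,Y$ having $A$ as part and being parts of $B$ one is part of the other; $A,B$ are externally diametrical to $C$ if both are externally tangent to $C$ and whenever $X,Y$ are external to $C$, $A$ is part of $X$ and $B$ is part of $Y$, then $X$ is external to $Y$; $A,B$ are internally diametrical to $C$ if both are internally tangent to $C$ and whenever $X,Y$ are external to $C$, $A$ is externally tangent to $X$ and $B$ to $Y$, then $X$ is external to $Y$. $\eta\,P\,(\mathrm{Point}(Q))$ iff $\eta\,P\,\mathrm{balls}$, $\eta\,Q\,\mathrm{balls}$ and $\eta\,P\,(\mathrm{Concent}(Q))$. Standing assumptions: concentricity is an equivalence relation on balls, and concentric balls $P,Q$ satisfy $\mathrm{Point}(P)\approx\mathrm{Point}(Q)$. Point-class notions: $\mathrm{same\_center}(P,Q)$ iff $\mathrm{Point}(P)\approx\mathrm{Point}(Q)$. $\mathrm{PointSet\_incl}(u,v)$ iff for all $B$ with $\eta\,B\,\mathrm{balls}$, $\eta\,B\,u$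 implies $\eta\,B\,v$. $\mathcal{G}(Q)=\mathrm{GBasicPointSet}(Q)$ is defined by: $\eta\,P\,\mathrm{GBasicPointSet}(Q)$ iff $\eta\,Q\,\mathrm{balls}$, $\eta\,P\,\mathrm{balls}$ and there is $C$ with $\eta\,C\,\mathrm{balls}$, $\mathrm{same\_center}(P,C)$ and $\eta\,C\,(\mathrm{pt}(Q))$. *)

theory Defs
  imports Main
begin

text \<open>
  Names are the elements of a type \<open>'n\<close>, and the predicate \<open>\<eta> A b\<close> is singular inclusion.
  A name-forming operator is a function on names. Instead of a definition it has a locale
  assumption \<open>op_iff\<close> stating when \<open>\<eta> P (op Q)\<close> holds; the operator \<open>pt\<close> is primitive.
\<close>

locale names =
  fixes \<eta> :: "'n \<Rightarrow> 'n \<Rightarrow> bool"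
begin

definition singular_eq :: "'n \<Rightarrow> 'n \<Rightarrow> bool" where
  "singular_eq P Q \<longleftrightarrow> \<eta> P Q \<and> \<eta> Q P"

definition weak_eq :: "'n \<Rightarrow> 'n \<Rightarrow> bool" where
  "weak_eq a b \<longleftrightarrow> (\<forall>P. \<eta> P a \<longleftrightarrow> \<eta> P b)"

definition individual :: "'n \<Rightarrow> bool" where
  "individual A \<longleftrightarrow> \<eta> A A"

end

text \<open>
  Interchangeability of names with the same extension in every context is, by Leibniz'
  principle, equality in HOL.
\<close>

locale ontology = names \<eta>
  for \<eta> :: "'n \<Rightarrow> 'n \<Rightarrow> bool" +
  assumes eta_iff:
      "\<eta> A b \<longleftrightarrow>
        (\<exists>C. \<eta> C A) \<and>
        (\<forall>C D. \<eta> C A \<and> \<eta> D A \<longrightarrow> \<eta> C D) \<and>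
        (\<forall>C. \<eta> C A \<longrightarrow> \<eta> C b)"
    and extensionality: "weak_eq a b \<Longrightarrow> a = b"

locale mereology = ontology \<eta>
  for \<eta> :: "'n \<Rightarrow> 'n \<Rightarrow> bool" +
  fixes pt :: "'n \<Rightarrow> 'n"
    and ext :: "'n \<Rightarrow> 'n"
  assumes pt_individuals: "\<eta> P (pt Q) \<Longrightarrow> individual P \<and> individual Q"
    and pt_refl: "individual P \<Longrightarrow> \<eta> P (pt P)"
    and pt_trans: "\<eta> P (pt Q) \<Longrightarrow> \<eta> Q (pt R) \<Longrightarrow> \<eta> P (pt R)"
    and pt_antisym: "\<eta> P (pt Q) \<Longrightarrow> \<eta> Q (pt P) \<Longrightarrow> singular_eq P Q"
    and ext_iff:
      "\<eta> P (ext Q) \<longleftrightarrow>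
        individual P \<and> individual Q \<and> \<not> (\<exists>R. \<eta> R (pt P) \<and> \<eta> R (pt Q))"
begin

definition proper_part :: "'n \<Rightarrow> 'n \<Rightarrow> bool" where
  "proper_part P Q \<longleftrightarrow> \<eta> P (pt Q) \<and> \<not> singular_eq P Q"

end

text \<open>
  That the members of \<open>balls\<close> are individuals need not be assumed: \<open>\<eta> B balls\<close> implies
  \<open>\<eta> B B\<close> by the axiom of Ontology.
\<close>

locale ball_mereology = mereology \<eta> pt ext
  for \<eta> :: "'n \<Rightarrow> 'n \<Rightarrow> bool" and pt ext :: "'n \<Rightarrow> 'n" +
  fixes balls :: 'n
  assumes ball_exists: "\<exists>B. \<eta> B balls"
begin

lemma ball_individual: "\<eta> B balls \<Longrightarrow> individual B"
  unfolding individual_def using eta_iff[of B balls] eta_iff[of B B] by blast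

definition ext_tangent :: "'n \<Rightarrow> 'n \<Rightarrow> bool" where
  "ext_tangent A B \<longleftrightarrow>
    \<eta> A balls \<and> \<eta> B balls \<and> \<eta> A (ext B) \<and>
    (\<forall>X Y. \<eta> X balls \<and> \<eta> Y balls \<and>
      \<eta> A (pt X) \<and> \<eta> X (ext B) \<and> \<eta> A (pt Y) \<and> \<eta> Y (ext B) \<longrightarrow>
      \<eta> X (pt Y) \<or> \<eta> Y (pt X))"

definition int_tangent :: "'n \<Rightarrow> 'n \<Rightarrow> bool" where
  "int_tangent A B \<longleftrightarrow>
    \<eta> A balls \<and> \<eta> B balls \<and> proper_part A B \<and>
    (\<forall>X Y. \<eta> X balls \<and> \<eta> Y balls \<and>
      \<eta> A (pt X) \<and> \<eta> X (pt B) \<and> \<eta> A (pt Y) \<and> \<eta> Y (pt B) \<longrightarrow>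
      \<eta> X (pt Y) \<or> \<eta> Y (pt X))"

definition ext_diametrical :: "'n \<Rightarrow> 'n \<Rightarrow> 'n \<Rightarrow> bool" where
  "ext_diametrical A B C \<longleftrightarrow>
    ext_tangent A C \<and> ext_tangent B C \<and>
    (\<forall>X Y. \<eta> X balls \<and> \<eta> Y balls \<and>
      \<eta> X (ext C) \<and> \<eta> Y (ext C) \<and> \<eta> A (pt X) \<and> \<eta> B (pt Y) \<longrightarrow>
      \<eta> X (ext Y))"

definition int_diametrical :: "'n \<Rightarrow> 'n \<Rightarrow> 'n \<Rightarrow> bool" where
  "int_diametrical A B C \<longleftrightarrow>
    int_tangent A C \<and> int_tangent B C \<and>
    (\<forall>X Y. \<eta> X balls \<and> \<eta> Y balls \<and>
      \<eta> X (ext C) \<and> \<eta> Y (ext C) \<and> ext_tangent A X \<and> ext_tangent B Y \<longrightarrow>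
      \<eta> X (ext Y))"

definition properly_concentric :: "'n \<Rightarrow> 'n \<Rightarrow> bool" where
  "properly_concentric P Q \<longleftrightarrow>
    proper_part P Q \<and>
    (\<forall>X Y. \<eta> X balls \<and> \<eta> Y balls \<and>
      ext_diametrical X Y P \<and> int_tangent X Q \<and> int_tangent Y Q \<longrightarrow>
      int_diametrical X Y Q)"

end

locale tarski_geometry = ball_mereology \<eta> pt ext balls
  for \<eta> :: "'n \<Rightarrow> 'n \<Rightarrow> bool" and pt ext :: "'n \<Rightarrow> 'n" and balls :: 'n +
  fixes Concent :: "'n \<Rightarrow> 'n"
    and Point :: "'n \<Rightarrow> 'n"
  assumes Concent_iff:
      "\<eta> P (Concent Q) \<longleftrightarrow>
        \<eta> P balls \<and> \<eta> Q balls \<and>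
        (singular_eq P Q \<or> properly_concentric P Q \<or> properly_concentric Q P)"
    and Point_iff:
      "\<eta> P (Point Q) \<longleftrightarrow> \<eta> P balls \<and> \<eta> Q balls \<and> \<eta> P (Concent Q)"
    and Concent_equiv: "equiv {P. \<eta> P balls} {(P, Q). \<eta> P (Concent Q)}"
    and Concent_Point:
      "\<eta> P balls \<Longrightarrow> \<eta> Q balls \<Longrightarrow> \<eta> P (Concent Q) \<Longrightarrow> weak_eq (Point P) (Point Q)"
begin

definition same_center :: "'n \<Rightarrow> 'n \<Rightarrow> bool" where
  "same_center P Q \<longleftrightarrow> weak_eq (Point P) (Point Q)"

definition PointSet_incl :: "'n \<Rightarrow> 'n \<Rightarrow> bool" where
  "PointSet_incl u v \<longleftrightarrow> (\<forall>B. \<eta> B balls \<longrightarrow> \<eta> B u \<longrightarrow> \<eta> B v)"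

end

locale point_set_geometry = tarski_geometry \<eta> pt ext balls Concent Point
  for \<eta> :: "'n \<Rightarrow> 'n \<Rightarrow> bool" and pt ext :: "'n \<Rightarrow> 'n" and balls :: 'n
    and Concent Point :: "'n \<Rightarrow> 'n" +
  fixes GBasicPointSet :: "'n \<Rightarrow> 'n"
  assumes GBasicPointSet_iff:
    "\<eta> P (GBasicPointSet Q) \<longleftrightarrow>
      \<eta> Q balls \<and> \<eta> P balls \<and>
      (\<exists>C. \<eta> C balls \<and> same_center P C \<and> \<eta> C (pt Q))"

end

theory Submission
  imports Defs
begin

text \<open>
  Of two concentric balls one is part of the other, because each case of Tarski's definition of
  concentricity is an identity or includes a proper parthood (\<open>concentric_balls_comparable\<close>).
  If \<open>P\<close> lies in \<open>\<G> B\<close> and in \<open>\<G> Q\<close>, with witnesses \<open>C\<close> inside \<open>B\<close> and \<open>C'\<close> inside \<open>Q\<close>, then \<open>C\<close> and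
  \<open>C'\<close> share the center of \<open>P\<close>; hence they are concentric (\<open>same_center_imp_Concent\<close>), and one of
  them is part of the other. The smaller one is therefore part of both \<open>B\<close> and \<open>Q\<close>, still has the
  center of \<open>P\<close>, and serves as \<open>D\<close> because \<open>\<G>\<close> is monotone in parthood (\<open>GBasicPointSet_mono\<close>).

  The cover property holds because a ball is a part of itself with its own center.
\<close>

context ontology
begin

text \<open>
  By the axiom of Ontology \<open>\<eta> A b\<close> makes the extension of \<open>A\<close> a subset of that of \<open>b\<close>, so two
  singular inclusions in opposite directions make the extensions coincide. The identity case of
  concentricity thus becomes an equality that can be substituted.
\<close>
lemma singular_eq_imp_eq:
  assumes "singular_eq P Q"
  shows "P = Q"
proof (rule extensionality)
  have "\<eta> P Q" and "\<eta> Q P"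
    using assms by (simp_all add: singular_eq_def)
  then show "weak_eq P Q"
    unfolding weak_eq_def using eta_iff[of P Q] eta_iff[of Q P] by blast
qed

end

context ball_mereology
begin

lemma ball_part_refl: "\<eta> B balls \<Longrightarrow> \<eta> B (pt B)"
  by (simp add: ball_individual pt_refl)

end

context tarski_geometry
begin

lemma Concent_refl: "\<eta> P balls \<Longrightarrow> \<eta> P (Concent P)"
  using Concent_equiv by (auto simp: equiv_def refl_on_def)

text \<open>
  Since \<open>P\<close> belongs to its own point, equality of the points of \<open>P\<close> and \<open>Q\<close> puts \<open>P\<close> into the
  point of \<open>Q\<close>.
\<close>
lemma same_center_imp_Concent:
  assumes "\<eta> P balls" and "same_center P Q"
  shows "\<eta> P (Concent Q)"
proof -
  have "\<eta> P (Point P)"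
    using assms(1) by (simp add: Point_iff Concent_refl)
  then have "\<eta> P (Point Q)"
    using assms(2) by (simp add: same_center_def weak_eq_def)
  then show ?thesis
    by (simp add: Point_iff)
qed

lemma same_center_refl: "same_center P P"
  by (simp add: same_center_def weak_eq_def)

lemma same_center_sym: "same_center P Q \<Longrightarrow> same_center Q P"
  by (simp add: same_center_def weak_eq_def)

lemma same_center_trans: "same_center P Q \<Longrightarrow> same_center Q R \<Longrightarrow> same_center P R"
  by (simp add: same_center_def weak_eq_def)

text \<open>
  The only link between concentricity and parthood that the intersection property relies on; it is
  what makes a smaller of two witnesses available.
\<close>
lemma concentric_balls_comparable:
  assumes "\<eta> P (Concent Q)"
  shows "\<eta> P (pt Q) \<or> \<eta> Q (pt P)"
proof -
  have P: "\<eta> P balls"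
    and "singular_eq P Q \<or> properly_concentric P Q \<or> properly_concentric Q P"
    using assms by (simp_all add: Concent_iff)
  then consider "P = Q" | "proper_part P Q" | "proper_part Q P"
    by (auto dest: singular_eq_imp_eq simp: properly_concentric_def)
  then show ?thesis
    using ball_part_refl[OF P] by cases (auto simp: proper_part_def)
qed

end

context point_set_geometry
begin

lemma ball_in_GBasicPointSet_self: "\<eta> P balls \<Longrightarrow> \<eta> P (GBasicPointSet P)"
  using GBasicPointSet_iff ball_part_refl same_center_refl by blast

lemma GBasicPointSet_mono:
  assumes "\<eta> Q balls" and "\<eta> D (pt Q)"
  shows "PointSet_incl (GBasicPointSet D) (GBasicPointSet Q)"
  unfolding PointSet_incl_def GBasicPointSet_iff using assms pt_trans by blast

text \<open>
  The core of the intersection property, with the two inclusions replaced by the parthoods that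
  imply them. The two witnesses for the membership of \<open>P\<close> are comparable, and \<open>D\<close> is the smaller.
\<close>
lemma common_concentric_part:
  assumes "\<eta> P (GBasicPointSet B)" and "\<eta> P (GBasicPointSet Q)"
  obtains D where "\<eta> D balls" "same_center P D" "\<eta> D (pt B)" "\<eta> D (pt Q)"
proof -
  obtain C where C: "\<eta> C balls" "same_center P C" "\<eta> C (pt B)"
    using assms(1) GBasicPointSet_iff by blast
  obtain C' where C': "\<eta> C' balls" "same_center P C'" "\<eta> C' (pt Q)"
    using assms(2) GBasicPointSet_iff by blast
  have "same_center C C'"
    using C(2) C'(2) same_center_sym same_center_trans by blast
  then have "\<eta> C (pt C') \<or> \<eta> C' (pt C)"
    using C(1) same_center_imp_Concent concentric_balls_comparable by blast
  then show thesis
  proof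
    assume "\<eta> C (pt C')"
    then show thesis using that C C'(3) pt_trans by blast
  next
    assume "\<eta> C' (pt C)"
    then show thesis using that C' C(3) pt_trans by blast
  qed
qed

lemma GBasicPointSet_intersection:
  assumes "\<eta> P (GBasicPointSet B)" and "\<eta> P (GBasicPointSet Q)"
  shows "\<exists>D. \<eta> D balls \<and> \<eta> P (GBasicPointSet D) \<and>
    PointSet_incl (GBasicPointSet D) (GBasicPointSet B) \<and>
    PointSet_incl (GBasicPointSet D) (GBasicPointSet Q)"
proof -
  obtain D where D: "\<eta> D balls" "same_center P D" "\<eta> D (pt B)" "\<eta> D (pt Q)"
    using assms by (rule common_concentric_part)
  have balls: "\<eta> P balls" "\<eta> B balls" "\<eta> Q balls"
    using assms by (simp_all add: GBasicPointSet_iff)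
  have "\<eta> P (GBasicPointSet D)"
    using D(1,2) balls(1) GBasicPointSet_iff ball_part_refl by blast
  then show ?thesis
    using D balls GBasicPointSet_mono by blast
qed

end

theorem theorem17:
  fixes \<eta> :: "'n \<Rightarrow> 'n \<Rightarrow> bool"
    and pt ext :: "'n \<Rightarrow> 'n"
    and balls :: 'n
    and Concent Point \<G> :: "'n \<Rightarrow> 'n"
  assumes "point_set_geometry \<eta> pt ext balls Concent Point \<G>"
  shows "(\<forall>P. \<eta> P balls \<longrightarrow> \<eta> P (\<G> P)) \<and>
    (\<forall>P B Q. \<eta> P (\<G> B) \<and> \<eta> P (\<G> Q) \<longrightarrow>
      (\<exists>D. \<eta> D balls \<and> \<eta> P (\<G> D) \<and>
        tarski_geometry.PointSet_incl \<eta> balls (\<G> D) (\<G> B) \<and>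
        tarski_geometry.PointSet_incl \<eta> balls (\<G> D) (\<G> Q)))"
proof -
  interpret point_set_geometry \<eta> pt ext balls Concent Point \<G>
    by (rule assms)
  show ?thesis
    using ball_in_GBasicPointSet_self GBasicPointSet_intersection by blast
qed

end
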